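(* Let $D$ be a finite set with $|D|\ge 2$, let $\mathbb{P}_0=(p_{0s})_{s\in D}$ be a probability measure on $D$ with $p_{0s}>0$ for all $s$, and let $c\ge 1$ satisfy $c<\min_{s\in D}\frac{1}{1-p_{0s}}$. Let there be a single risky asset ($K=1$) with non-constant payoff $S:D\to\mathbb{R}$, and put $\underline S=\min_{s\in D}S_s$, $\overline S=\max_{s\in D}S_s$. Let $u$ be a strictly increasing, strictly concave, twice differentiable utility function satisfying the Inada conditions, and consider $\alpha\in(1/2,1]$. Let $\theta^*$ denote the optimal demand, i.e. the unique maximizer of $V_\alpha$ over the admissible set $\Theta$. If the relative risk aversion of $u$ is bounded from below by one, i.e. $-x\,u''(x)/u'(x)\ge 1$ for all $x$ in the domain of $u$, then $\theta^*$ as a function of $\alpha$ is increasing for prices $\pi\in(\overline\pi,\overline S)$ and decreasing for prices $\pi\in(\underline S,\underline\pi)$.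
   Context: With initial wealth $w_0$ and price $\pi$, $W^\theta=w_0+\theta(S-\pi)$ and $$V_\alpha(\theta)=\alpha\min_{P\in\mathcal{X}}\mathbb{E}_P[u(W^\theta)]+(1-\alpha)\max_{P\in\mathcal{X}}\mathbb{E}_P[u(W^\theta)],$$ where $\mathcal{X}=\{P: P(s)\ge 0\ \forall s\in D,\ \sum_{s}P(s)=1,\ \sum_{s}P(s)^2/p_{0s}\le c\}$. Write $\mathbb{E}_0,\mathbb{S}_0$ for expectation and standard deviation under $\mathbb{P}_0$, $\delta=\sqrt{c-1}\,(2\alpha-1)$, and $$\overline\pi=\mathbb{E}_0[S]+|\delta|\,\mathbb{S}_0[S],\qquad \underline\pi=\mathbb{E}_0[S]-|\delta|\,\mathbb{S}_0[S];$$ these depend on $\alpha$. For a fixed price $\pi$, the monotonicity statements refer to the set of those $\alpha\in(1/2,1]$ for which $\pi$ lies in the indicated interval. Two cases are considered. (1) $u$ is defined on all of $\mathbb{R}$ and the admissible set is $\Theta=\mathbb{R}$. (2) $u$ is defined only on $(0,\infty)$, $w_0>0$ and $\Theta=\{\theta\in\mathbb{R}: w_0+\theta(S_s-\pi)>0\ \forall s\in D\}$. Inada conditions: $\lim_{x\downarrow-\infty}u'(x)=+\infty$ in case (1), $\lim_{x\downarrow0}u'(x)=+\infty$ in case (2), and $\lim_{x\uparrow+\infty}u'(x)=0$ in both cases. *)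

theory Defs
  imports "HOL-Analysis.Analysis"
begin

text \<open>
  Measures on the finite set \<open>D\<close> are given by their weights. All notions below depend only on the
  values of the weights and of the random variables on \<open>D\<close>.
\<close>

definition expectation :: "'s set \<Rightarrow> ('s \<Rightarrow> real) \<Rightarrow> ('s \<Rightarrow> real) \<Rightarrow> real" where
  "expectation D P X = (\<Sum>s\<in>D. P s * X s)"

definition std_dev :: "'s set \<Rightarrow> ('s \<Rightarrow> real) \<Rightarrow> ('s \<Rightarrow> real) \<Rightarrow> real" where
  "std_dev D P X = sqrt (expectation D P (\<lambda>s. (X s - expectation D P X)\<^sup>2))"

definition priors :: "'s set \<Rightarrow> ('s \<Rightarrow> real) \<Rightarrow> real \<Rightarrow> ('s \<Rightarrow> real) set" where
  "priors D p0 c =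
     {P. (\<forall>s\<in>D. 0 \<le> P s) \<and> (\<Sum>s\<in>D. P s) = 1 \<and> (\<Sum>s\<in>D. (P s)\<^sup>2 / p0 s) \<le> c}"

definition wealth :: "real \<Rightarrow> real \<Rightarrow> ('s \<Rightarrow> real) \<Rightarrow> real \<Rightarrow> 's \<Rightarrow> real" where
  "wealth w0 \<pi> S \<theta> s = w0 + \<theta> * (S s - \<pi>)"

text \<open>
  The infimum and supremum in the following definition are a minimum and a maximum: restricted to
  \<open>D\<close>, the priors form a compact set, which contains \<open>p0\<close> whenever \<open>p0\<close> is a strictly positive
  probability measure and \<open>c \<ge> 1\<close>, and the expectation is linear in the prior.
\<close>

definition alpha_meu ::
  "'s set \<Rightarrow> ('s \<Rightarrow> real) \<Rightarrow> real \<Rightarrow> ('s \<Rightarrow> real) \<Rightarrow> (real \<Rightarrow> real) \<Rightarrow> real \<Rightarrow> real \<Rightarrow> real \<Rightarrow> real \<Rightarrow> real"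
  where
  "alpha_meu D p0 c S u w0 \<pi> \<alpha> \<theta> =
     \<alpha> * (INF P\<in>priors D p0 c. expectation D P (\<lambda>s. u (wealth w0 \<pi> S \<theta> s)))
     + (1 - \<alpha>) * (SUP P\<in>priors D p0 c. expectation D P (\<lambda>s. u (wealth w0 \<pi> S \<theta> s)))"

text \<open>
  \<open>U\<close> is the domain of the utility function: \<open>UNIV\<close>, in which case every demand is admissible, or
  \<open>{0<..}\<close>, in which case terminal wealth has to be positive in every state.
\<close>

definition admissible ::
  "real set \<Rightarrow> 's set \<Rightarrow> ('s \<Rightarrow> real) \<Rightarrow> real \<Rightarrow> real \<Rightarrow> real set" where
  "admissible U D S w0 \<pi> = {\<theta>. \<forall>s\<in>D. wealth w0 \<pi> S \<theta> s \<in> U}"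

definition optimal_demand ::
  "real set \<Rightarrow> 's set \<Rightarrow> ('s \<Rightarrow> real) \<Rightarrow> real \<Rightarrow> ('s \<Rightarrow> real) \<Rightarrow> (real \<Rightarrow> real)
     \<Rightarrow> real \<Rightarrow> real \<Rightarrow> real \<Rightarrow> real" where
  "optimal_demand U D p0 c S u w0 \<pi> \<alpha> =
     (THE \<theta>. is_arg_max (alpha_meu D p0 c S u w0 \<pi> \<alpha>) (\<lambda>\<eta>. \<eta> \<in> admissible U D S w0 \<pi>) \<theta>)"

definition ambiguity_delta :: "real \<Rightarrow> real \<Rightarrow> real" where
  "ambiguity_delta c \<alpha> = sqrt (c - 1) * (2 * \<alpha> - 1)"

definition upper_price :: "'s set \<Rightarrow> ('s \<Rightarrow> real) \<Rightarrow> real \<Rightarrow> ('s \<Rightarrow> real) \<Rightarrow> real \<Rightarrow> real" where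
  "upper_price D p0 c S \<alpha> = expectation D p0 S + \<bar>ambiguity_delta c \<alpha>\<bar> * std_dev D p0 S"

definition lower_price :: "'s set \<Rightarrow> ('s \<Rightarrow> real) \<Rightarrow> real \<Rightarrow> ('s \<Rightarrow> real) \<Rightarrow> real \<Rightarrow> real" where
  "lower_price D p0 c S \<alpha> = expectation D p0 S - \<bar>ambiguity_delta c \<alpha>\<bar> * std_dev D p0 S"

definition strictly_concave_on :: "real set \<Rightarrow> (real \<Rightarrow> real) \<Rightarrow> bool" where
  "strictly_concave_on U f \<longleftrightarrow> convex U \<and>
     (\<forall>x\<in>U. \<forall>y\<in>U. \<forall>t\<in>{0<..<1}. x \<noteq> y \<longrightarrow>
        (1 - t) * f x + t * f y < f ((1 - t) * x + t * y))"

end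

theory Submission
  imports Defs
begin

text \<open>
  The bound on \<open>c\<close> makes the nonnegativity constraint on the priors slack, so that by Cauchy-Schwarz
  the extreme expectations of \<open>X\<close> are the mean under \<open>p0\<close> plus or minus \<open>sqrt (c - 1)\<close> standard
  deviations, and the criterion becomes the mean of utility minus \<open>ambiguity_delta c \<alpha>\<close> times its
  standard deviation. A relative risk aversion of at least one sends utility to \<open>-\<infinity>\<close> at zero wealth,
  whence a maximizer exists; its sign is that of the expected excess payoff by Jensen's inequality.
  A revealed preference argument then compares the maximizers for two values of \<open>\<alpha>\<close>.
\<close>

section \<open>Extreme expectations over a chi-squared ball of priors\<close>

locale ambiguity_ball =
  fixes D :: "'s set" and p0 :: "'s \<Rightarrow> real" and c :: real
  assumes finite_D: "finite D"
    and p0_pos: "s \<in> D \<Longrightarrow> 0 < p0 s"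
    and p0_sum: "(\<Sum>s\<in>D. p0 s) = 1"
    and c_ge_1: "1 \<le> c"
    and c_less: "s \<in> D \<Longrightarrow> c < 1 / (1 - p0 s)"
begin

text \<open>Since division by zero yields 0, the bound \<open>c < 1 / (1 - p0 s)\<close> with
  \<open>c\<close> at least 1 also excludes \<open>p0 s = 1\<close>.\<close>

lemma p0_less_1:
  assumes "s \<in> D" shows "p0 s < 1"
proof -
  have "0 < 1 / (1 - p0 s)"
    using c_less[OF assms] c_ge_1 by linarith
  then show ?thesis
    by (simp add: zero_less_divide_iff)
qed

lemma expectation_const: "expectation D p0 (\<lambda>s. a) = a"
  by (simp add: expectation_def p0_sum flip: sum_distrib_right)

lemma expectation_centred: "(\<Sum>s\<in>D. p0 s * (X s - expectation D p0 X)) = 0"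
  by (simp add: right_diff_distrib sum_subtractf p0_sum expectation_def flip: sum_distrib_right)

lemma std_dev_nonneg: "0 \<le> std_dev D p0 X"
  by (auto simp: std_dev_def expectation_def intro!: sum_nonneg mult_nonneg_nonneg less_imp_le[OF p0_pos])

lemma std_dev_power2: "(std_dev D p0 X)\<^sup>2 = (\<Sum>s\<in>D. p0 s * (X s - expectation D p0 X)\<^sup>2)"
  unfolding std_dev_def
  by (subst real_sqrt_pow2)
     (auto simp: expectation_def intro!: sum_nonneg mult_nonneg_nonneg less_imp_le[OF p0_pos])

text \<open>The second moment about \<open>a\<close> splits into variance and squared bias, as the
  deviations from the mean cancel in the cross term.\<close>

lemma std_dev_power2_shift:
  "(std_dev D p0 X)\<^sup>2 = expectation D p0 (\<lambda>s. (X s - a)\<^sup>2) - (expectation D p0 X - a)\<^sup>2"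
proof -
  define m where "m = expectation D p0 X"
  have "p0 s * (X s - a)\<^sup>2 = p0 s * (X s - m)\<^sup>2 + (2 * (m - a)) * (p0 s * (X s - m)) + (m - a)\<^sup>2 * p0 s" for s
    by (simp add: power2_eq_square algebra_simps)
  then have "expectation D p0 (\<lambda>s. (X s - a)\<^sup>2)
      = (\<Sum>s\<in>D. p0 s * (X s - m)\<^sup>2) + (2 * (m - a)) * (\<Sum>s\<in>D. p0 s * (X s - m)) + (m - a)\<^sup>2 * (\<Sum>s\<in>D. p0 s)"
    by (simp add: expectation_def sum.distrib sum_distrib_left)
  then show ?thesis
    by (simp add: std_dev_power2 p0_sum expectation_centred m_def)
qed

lemma std_dev_uminus: "std_dev D p0 (\<lambda>s. - X s) = std_dev D p0 X"
proof -
  have "expectation D p0 (\<lambda>s. - X s) = - expectation D p0 X"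
    by (simp add: expectation_def sum_negf)
  then show ?thesis
    by (simp add: std_dev_def power2_commute)
qed

text \<open>A weighted form of Samuelson's inequality: the deviation at \<open>s\<close> is balanced
  by those at the other states, of total weight \<open>1 - p0 s\<close>, and Cauchy-Schwarz applies
  on \<open>D - {s}\<close>. It controls the sign of the worst-case prior.\<close>

lemma deviation_le_std_dev:
  assumes "s \<in> D"
  shows "p0 s * (X s - expectation D p0 X)\<^sup>2 \<le> (1 - p0 s) * (std_dev D p0 X)\<^sup>2"
proof -
  define y where "y t = X t - expectation D p0 X" for t
  let ?R = "\<Sum>t\<in>D - {s}. p0 t * (y t)\<^sup>2"
  have "p0 s * y s = - (\<Sum>t\<in>D - {s}. p0 t * y t)"
    using expectation_centred[of X] sum.remove[OF finite_D assms, of "\<lambda>t. p0 t * y t"]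
    by (simp add: y_def)
  then have "(p0 s * y s)\<^sup>2 = (\<Sum>t\<in>D - {s}. p0 t * y t)\<^sup>2"
    by simp
  also have "\<dots> = (\<Sum>t\<in>D - {s}. sqrt (p0 t) * (sqrt (p0 t) * y t))\<^sup>2"
    using p0_pos by (intro arg_cong[where f = "\<lambda>z. z\<^sup>2"] sum.cong)
      (auto simp: less_imp_le simp flip: mult.assoc)
  also have "\<dots> \<le> (\<Sum>t\<in>D - {s}. (sqrt (p0 t))\<^sup>2) * (\<Sum>t\<in>D - {s}. (sqrt (p0 t) * y t)\<^sup>2)"
    by (rule Cauchy_Schwarz_ineq_sum)
  also have "\<dots> = (\<Sum>t\<in>D - {s}. p0 t) * ?R"
    using p0_pos by (intro arg_cong2[where f = "(*)"] sum.cong)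
      (auto simp: power_mult_distrib less_imp_le)
  also have "(\<Sum>t\<in>D - {s}. p0 t) = 1 - p0 s"
    using sum.remove[OF finite_D assms, of p0] by (simp add: p0_sum)
  finally have "(p0 s * y s)\<^sup>2 \<le> (1 - p0 s) * ?R" .
  moreover have "(std_dev D p0 X)\<^sup>2 = p0 s * (y s)\<^sup>2 + ?R"
    unfolding std_dev_power2 y_def by (rule sum.remove[OF finite_D assms])
  ultimately show ?thesis
    unfolding y_def[symmetric] by (simp add: power2_eq_square algebra_simps)
qed

text \<open>Cauchy-Schwarz weighted by \<open>p0\<close>: the chi-squared distance of
  \<open>P\<close> from \<open>p0\<close> is
  \<open>(\<Sum>s\<in>D. (P s)\<^sup>2 / p0 s) - 1\<close>, hence at most
  \<open>c - 1\<close>.\<close>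

lemma expectation_ge_robust:
  assumes "P \<in> priors D p0 c"
  shows "expectation D p0 X - sqrt (c - 1) * std_dev D p0 X \<le> expectation D P X"
proof -
  define m where "m = expectation D p0 X"
  have P: "(\<Sum>s\<in>D. P s) = 1" "(\<Sum>s\<in>D. (P s)\<^sup>2 / p0 s) \<le> c"
    using assms by (auto simp: priors_def)
  have "expectation D P X - m = (\<Sum>s\<in>D. (P s - p0 s) * (X s - m))"
    by (simp add: left_diff_distrib right_diff_distrib sum_subtractf P p0_sum
        expectation_def m_def flip: sum_distrib_right)
  also have "\<dots> = (\<Sum>s\<in>D. ((P s - p0 s) / sqrt (p0 s)) * (sqrt (p0 s) * (X s - m)))"
    by (intro sum.cong) (auto dest: p0_pos)
  finally have "(expectation D P X - m)\<^sup>2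
      \<le> (\<Sum>s\<in>D. ((P s - p0 s) / sqrt (p0 s))\<^sup>2) * (\<Sum>s\<in>D. (sqrt (p0 s) * (X s - m))\<^sup>2)"
    by (simp only: Cauchy_Schwarz_ineq_sum)
  also have "(\<Sum>s\<in>D. (sqrt (p0 s) * (X s - m))\<^sup>2) = (std_dev D p0 X)\<^sup>2"
    unfolding std_dev_power2 m_def using p0_pos
    by (intro sum.cong) (auto simp: power_mult_distrib less_imp_le)
  also have "(\<Sum>s\<in>D. ((P s - p0 s) / sqrt (p0 s))\<^sup>2) = (\<Sum>s\<in>D. (P s)\<^sup>2 / p0 s - 2 * P s + p0 s)"
  proof (intro sum.cong refl)
    fix s assume "s \<in> D"
    from p0_pos[OF this] show "((P s - p0 s) / sqrt (p0 s))\<^sup>2 = (P s)\<^sup>2 / p0 s - 2 * P s + p0 s"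
      by (simp add: power_divide field_simps power2_eq_square)
  qed
  also have "\<dots> = (\<Sum>s\<in>D. (P s)\<^sup>2 / p0 s) - 1"
    by (simp add: sum.distrib sum_subtractf P p0_sum flip: sum_distrib_left)
  also have "((\<Sum>s\<in>D. (P s)\<^sup>2 / p0 s) - 1) * (std_dev D p0 X)\<^sup>2 \<le> (c - 1) * (std_dev D p0 X)\<^sup>2"
    using P by (intro mult_right_mono) auto
  also have "\<dots> = (sqrt (c - 1) * std_dev D p0 X)\<^sup>2"
    using c_ge_1 by (simp add: power_mult_distrib)
  finally have "\<bar>expectation D P X - m\<bar> \<le> sqrt (c - 1) * std_dev D p0 X"
    using c_ge_1 by (intro power2_le_imp_le[of "\<bar>_\<bar>"]) (auto simp: std_dev_nonneg)
  then show ?thesis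
    by (simp add: m_def)
qed

text \<open>The bound on \<open>c\<close> keeps the worst-case prior of the unconstrained ball strictly positive.
  If the standard deviation vanishes, division by zero makes the witness equal to \<open>p0\<close>.\<close>

lemma robust_expectation_attained:
  obtains P where "P \<in> priors D p0 c" "\<And>s. s \<in> D \<Longrightarrow> 0 < P s"
    "expectation D P X = expectation D p0 X - sqrt (c - 1) * std_dev D p0 X"
proof
  define m where "m = expectation D p0 X"
  define \<sigma> where "\<sigma> = std_dev D p0 X"
  define k where "k = sqrt (c - 1)"
  \<comment> \<open>The equality case of Cauchy-Schwarz: the density with respect to
    \<open>p0\<close> is affine and nonincreasing in \<open>X\<close>, and for nonzero
    \<open>\<sigma>\<close> the factor \<open>k / \<sigma>\<close> uses up the whole budget
    \<open>c - 1\<close>.\<close>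
  define P where "P s = p0 s * (1 - k * ((X s - m) / \<sigma>))" for s
  have k: "0 \<le> k" "k\<^sup>2 = c - 1"
    using c_ge_1 by (auto simp: k_def)
  have centred: "(\<Sum>s\<in>D. p0 s * (X s - m)) = 0"
    unfolding m_def by (rule expectation_centred)
  have var: "(\<Sum>s\<in>D. p0 s * (X s - m)\<^sup>2) = \<sigma>\<^sup>2"
    by (simp add: std_dev_power2 \<sigma>_def m_def)
  have \<sigma>: "0 \<le> \<sigma>"
    by (simp add: \<sigma>_def std_dev_nonneg)
  show pos: "0 < P s" if s: "s \<in> D" for s
  proof -
    have "k * ((X s - m) / \<sigma>) < 1"
    proof (cases "\<sigma> = 0")
      case False
      with \<sigma> have \<sigma>': "0 < \<sigma>" by simp
      have p: "0 < p0 s" "p0 s < 1" using p0_pos p0_less_1 s by auto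
      have "p0 s * (k * (X s - m))\<^sup>2 = k\<^sup>2 * (p0 s * (X s - m)\<^sup>2)"
        by (simp add: power_mult_distrib)
      also have "\<dots> \<le> (c - 1) * ((1 - p0 s) * \<sigma>\<^sup>2)"
        unfolding k m_def \<sigma>_def using c_ge_1
        by (intro mult_left_mono deviation_le_std_dev s) auto
      also have "\<dots> = ((c - 1) * (1 - p0 s)) * \<sigma>\<^sup>2"
        by simp
      \<comment> \<open>The bound \<open>c < 1 / (1 - p0 s)\<close> is equivalent to
        \<open>(c - 1) * (1 - p0 s) < p0 s\<close>.\<close>
      also have "\<dots> < p0 s * \<sigma>\<^sup>2"
        using c_less[OF s] p \<sigma>' by (intro mult_strict_right_mono) (auto simp: field_simps)
      finally have "(k * (X s - m))\<^sup>2 < \<sigma>\<^sup>2"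
        using p by simp
      then have "k * (X s - m) < \<sigma>"
        using \<sigma> by (rule power2_less_imp_less)
      then show ?thesis
        using \<sigma>' by (simp add: field_simps)
    qed simp
    then show ?thesis
      using p0_pos[OF s] by (simp add: P_def)
  qed
  have "(\<Sum>s\<in>D. P s) = (\<Sum>s\<in>D. p0 s) - k / \<sigma> * (\<Sum>s\<in>D. p0 s * (X s - m))"
    unfolding P_def sum_distrib_left sum_subtractf[symmetric]
    by (intro sum.cong refl) (simp add: field_simps)
  then have P1: "(\<Sum>s\<in>D. P s) = 1"
    by (simp add: p0_sum centred)
  have "(\<Sum>s\<in>D. (P s)\<^sup>2 / p0 s)
      = (\<Sum>s\<in>D. p0 s - 2 * k / \<sigma> * (p0 s * (X s - m)) + (k / \<sigma>)\<^sup>2 * (p0 s * (X s - m)\<^sup>2))"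
  proof (intro sum.cong refl)
    fix s assume "s \<in> D"
    have "(P s)\<^sup>2 / p0 s = p0 s * (1 - k * ((X s - m) / \<sigma>))\<^sup>2"
      using p0_pos[OF \<open>s \<in> D\<close>] by (simp add: P_def power2_eq_square)
    also have "\<dots> = p0 s - 2 * k / \<sigma> * (p0 s * (X s - m)) + (k / \<sigma>)\<^sup>2 * (p0 s * (X s - m)\<^sup>2)"
      by (cases "\<sigma> = 0") (simp_all add: power2_eq_square field_simps)
    finally show "(P s)\<^sup>2 / p0 s
        = p0 s - 2 * k / \<sigma> * (p0 s * (X s - m)) + (k / \<sigma>)\<^sup>2 * (p0 s * (X s - m)\<^sup>2)" .
  qed
  also have "\<dots> = 1 - 2 * k / \<sigma> * (\<Sum>s\<in>D. p0 s * (X s - m))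
      + (k / \<sigma>)\<^sup>2 * (\<Sum>s\<in>D. p0 s * (X s - m)\<^sup>2)"
    by (simp only: sum.distrib sum_subtractf sum_distrib_left p0_sum)
  also have "\<dots> = 1 + (k / \<sigma>)\<^sup>2 * \<sigma>\<^sup>2"
    by (simp add: centred var)
  also have "\<dots> \<le> c"
    using k c_ge_1 by (cases "\<sigma> = 0") (auto simp: power_divide)
  finally show "P \<in> priors D p0 c"
    using P1 pos by (auto simp: priors_def intro: less_imp_le)
  have "expectation D P X = (\<Sum>s\<in>D. P s * (X s - m)) + m * (\<Sum>s\<in>D. P s)"
    by (simp add: expectation_def right_diff_distrib sum_subtractf sum_distrib_left mult_ac)
  also have "(\<Sum>s\<in>D. P s * (X s - m))
      = (\<Sum>s\<in>D. p0 s * (X s - m)) - k / \<sigma> * (\<Sum>s\<in>D. p0 s * (X s - m)\<^sup>2)"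
    unfolding P_def sum_distrib_left sum_subtractf[symmetric]
    by (intro sum.cong refl) (simp add: power2_eq_square field_simps)
  also have "\<dots> = - (k * \<sigma>)"
    unfolding centred var by (cases "\<sigma> = 0") (simp_all add: power2_eq_square)
  finally show "expectation D P X = expectation D p0 X - sqrt (c - 1) * std_dev D p0 X"
    by (simp add: P1 m_def k_def \<sigma>_def)
qed

lemma INF_expectation_priors:
  "(INF P\<in>priors D p0 c. expectation D P X) = expectation D p0 X - sqrt (c - 1) * std_dev D p0 X"
proof (rule cInf_eq_minimum)
  obtain P where "P \<in> priors D p0 c"
    "expectation D P X = expectation D p0 X - sqrt (c - 1) * std_dev D p0 X"
    by (rule robust_expectation_attained)
  then show "expectation D p0 X - sqrt (c - 1) * std_dev D p0 X
      \<in> (\<lambda>P. expectation D P X) ` priors D p0 c"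
    by force
qed (auto intro: expectation_ge_robust)

text \<open>The supremum for \<open>X\<close> is minus the infimum for \<open>-X\<close>, and both
  variables have the same standard deviation.\<close>

lemma SUP_expectation_priors:
  "(SUP P\<in>priors D p0 c. expectation D P X) = expectation D p0 X + sqrt (c - 1) * std_dev D p0 X"
proof -
  have "expectation D P (\<lambda>s. - X s) = - expectation D P X" for P
    by (simp add: expectation_def sum_negf)
  then have "(INF P\<in>priors D p0 c. - expectation D P X)
      = - expectation D p0 X - sqrt (c - 1) * std_dev D p0 X"
    using INF_expectation_priors[of "\<lambda>s. - X s"] by (simp add: std_dev_uminus)
  then show ?thesis
    by (simp add: Inf_real_def image_image)
qed

text \<open>The weights \<open>\<alpha>\<close> and \<open>1 - \<alpha>\<close> add up to 1 on the
  mean and leave the net coefficient \<open>(1 - 2 * \<alpha>) * sqrt (c - 1)\<close> on the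
  standard deviation.\<close>

lemma alpha_meu_mean_std_dev:
  fixes S u w0 \<pi> \<theta>
  defines "X \<equiv> \<lambda>s. u (wealth w0 \<pi> S \<theta> s)"
  shows "alpha_meu D p0 c S u w0 \<pi> \<alpha> \<theta>
    = expectation D p0 X - ambiguity_delta c \<alpha> * std_dev D p0 X"
  by (simp add: alpha_meu_def INF_expectation_priors SUP_expectation_priors X_def
      ambiguity_delta_def algebra_simps)

end


section \<open>The market with positive terminal wealth\<close>

text \<open>The assumption \<open>u_at_bot\<close> is what the bound on relative risk aversion
  contributes. The last two place the price strictly between the extreme payoffs.\<close>

locale robust_market = ambiguity_ball D p0 c
  for D :: "'s set" and p0 :: "'s \<Rightarrow> real" and c :: real +
  fixes S :: "'s \<Rightarrow> real" and u :: "real \<Rightarrow> real" and w0 \<pi> :: real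
  assumes w0_pos: "0 < w0"
    and mono_u: "strict_mono_on {0<..} u"
    and concave_u: "strictly_concave_on {0<..} u"
    and continuous_u: "continuous_on {0<..} u"
    and u_at_bot: "filterlim u at_bot (at_right 0)"
    and ex_above: "\<exists>s\<in>D. \<pi> < S s"
    and ex_below: "\<exists>s\<in>D. S s < \<pi>"
begin

abbreviation W :: "real \<Rightarrow> 's \<Rightarrow> real" where
  "W \<equiv> wealth w0 \<pi> S"

abbreviation EU :: "real \<Rightarrow> real" where
  "EU \<theta> \<equiv> expectation D p0 (\<lambda>s. u (W \<theta> s))"

abbreviation SU :: "real \<Rightarrow> real" where
  "SU \<theta> \<equiv> std_dev D p0 (\<lambda>s. u (W \<theta> s))"

abbreviation V :: "real \<Rightarrow> real \<Rightarrow> real" where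
  "V \<equiv> alpha_meu D p0 c S u w0 \<pi>"

abbreviation \<Theta> :: "real set" where
  "\<Theta> \<equiv> admissible {0<..} D S w0 \<pi>"

abbreviation \<theta>opt :: "real \<Rightarrow> real" where
  "\<theta>opt \<equiv> optimal_demand {0<..} D p0 c S u w0 \<pi>"

lemma u_mono: "0 < x \<Longrightarrow> x \<le> y \<Longrightarrow> u x \<le> u y"
  using strict_mono_on_imp_mono_on[OF mono_u] by (auto simp: mono_on_def)

lemma admissible_iff: "\<theta> \<in> \<Theta> \<longleftrightarrow> (\<forall>s\<in>D. 0 < W \<theta> s)"
  by (simp add: admissible_def)

lemma zero_admissible: "0 \<in> \<Theta>"
  using w0_pos by (simp add: admissible_iff wealth_def)

lemma ambiguity_delta_mono: "\<alpha> \<le> \<beta> \<Longrightarrow> ambiguity_delta c \<alpha> \<le> ambiguity_delta c \<beta>"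
  using c_ge_1 by (auto simp: ambiguity_delta_def intro!: mult_left_mono)

lemma ambiguity_delta_nonneg: "1/2 < \<alpha> \<Longrightarrow> 0 \<le> ambiguity_delta c \<alpha>"
  using c_ge_1 by (simp add: ambiguity_delta_def)

lemma alpha_meu_le_expectation:
  assumes "1/2 < \<alpha>" shows "V \<alpha> \<theta> \<le> EU \<theta>"
  using mult_nonneg_nonneg[OF ambiguity_delta_nonneg[OF assms] std_dev_nonneg]
  by (simp add: alpha_meu_mean_std_dev)

lemma alpha_meu_0: "V \<alpha> 0 = u w0"
  by (simp add: alpha_meu_mean_std_dev wealth_def expectation_const std_dev_def)

lemma midpoint_admissible:
  assumes "a \<in> \<Theta>" "b \<in> \<Theta>" shows "(a + b) / 2 \<in> \<Theta>"
  unfolding admissible_iff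
proof
  fix s assume "s \<in> D"
  have "W ((a + b) / 2) s = (W a s + W b s) / 2"
    by (simp add: wealth_def field_simps)
  moreover have "0 < W a s" "0 < W b s"
    using assms \<open>s \<in> D\<close> by (auto simp: admissible_iff)
  ultimately show "0 < W ((a + b) / 2) s"
    by (simp only: half_gt_zero_iff add_pos_pos)
qed

section \<open>Strict concavity of the criterion\<close>

lemma u_midpoint:
  assumes "0 < x" "0 < y"
  shows "(u x + u y) / 2 \<le> u ((x + y) / 2)" "x \<noteq> y \<Longrightarrow> (u x + u y) / 2 < u ((x + y) / 2)"
proof -
  show *: "x \<noteq> y \<Longrightarrow> (u x + u y) / 2 < u ((x + y) / 2)"
    using concave_u[unfolded strictly_concave_on_def, THEN conjunct2, rule_format, of x y "1/2"] assms
    by (simp add: add_divide_distrib)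
  show "(u x + u y) / 2 \<le> u ((x + y) / 2)"
    using * by (cases "x = y") (auto intro: less_imp_le)
qed

text \<open>\<open>V\<close> is a positive multiple of the worst-case expected utility plus a nonnegative multiple of
  the expected utility under \<open>p0\<close>. The worst case at the midpoint is attained at a prior of full
  support, under which expected utility is strictly concave.\<close>

lemma alpha_meu_midpoint:
  assumes \<alpha>: "1/2 < \<alpha>" "\<alpha> \<le> 1" and ab: "a \<in> \<Theta>" "b \<in> \<Theta>" "a \<noteq> b"
  shows "(V \<alpha> a + V \<alpha> b) / 2 < V \<alpha> ((a + b) / 2)"
proof -
  let ?m = "(a + b) / 2"
  let ?X = "\<lambda>\<theta> s. u (W \<theta> s)"
  let ?L = "\<lambda>\<theta>. EU \<theta> - sqrt (c - 1) * SU \<theta>"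
  have V: "V \<alpha> \<theta> = (2 * \<alpha> - 1) * ?L \<theta> + 2 * (1 - \<alpha>) * EU \<theta>" for \<theta>
    by (simp add: alpha_meu_mean_std_dev ambiguity_delta_def algebra_simps)
  obtain P where P: "P \<in> priors D p0 c" "\<And>s. s \<in> D \<Longrightarrow> 0 < P s" "expectation D P (?X ?m) = ?L ?m"
    using robust_expectation_attained[of "?X ?m"] by blast
  have Wm: "W ?m s = (W a s + W b s) / 2" for s
    by (simp add: wealth_def field_simps)
  have X: "(?X a s + ?X b s) / 2 \<le> ?X ?m s" if "s \<in> D" for s
    unfolding Wm using ab that by (intro u_midpoint) (auto simp: admissible_iff)
  \<comment> \<open>A state whose payoff differs from the price separates the wealths of the two
    demands, which makes the concavity inequality strict there.\<close>
  obtain s0 where s0: "s0 \<in> D" "\<pi> < S s0"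
    using ex_above by blast
  have X0: "(?X a s0 + ?X b s0) / 2 < ?X ?m s0"
    unfolding Wm using ab s0 by (intro u_midpoint) (auto simp: admissible_iff wealth_def)
  have avg: "(expectation D Q (?X a) + expectation D Q (?X b)) / 2
      = expectation D Q (\<lambda>s. (?X a s + ?X b s) / 2)" for Q
    by (simp add: expectation_def sum_divide_distrib algebra_simps flip: sum.distrib)
  \<comment> \<open>\<open>P\<close> is chosen as the worst case at the midpoint. At
    \<open>a\<close> and \<open>b\<close> it is just some prior, so its expectations bound the worst
    cases from above.\<close>
  have "(?L a + ?L b) / 2 \<le> (expectation D P (?X a) + expectation D P (?X b)) / 2"
    using expectation_ge_robust[OF P(1), of "?X a"] expectation_ge_robust[OF P(1), of "?X b"] by simp
  also have "\<dots> < expectation D P (?X ?m)"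
    unfolding avg unfolding expectation_def
    using finite_D s0(1) P(2) X X0
    by (intro sum_strict_mono_ex1 ballI mult_left_mono less_imp_le[OF P(2)] bexI[of _ s0]) auto
  finally have L: "(?L a + ?L b) / 2 < ?L ?m"
    by (simp add: P)
  have E: "(EU a + EU b) / 2 \<le> EU ?m"
    unfolding avg unfolding expectation_def
    by (intro sum_mono mult_left_mono X) (auto intro: less_imp_le[OF p0_pos])
  have "(V \<alpha> a + V \<alpha> b) / 2
      = (2 * \<alpha> - 1) * ((?L a + ?L b) / 2) + 2 * (1 - \<alpha>) * ((EU a + EU b) / 2)"
    unfolding V by (simp add: field_simps)
  also have "\<dots> < (2 * \<alpha> - 1) * ?L ?m + 2 * (1 - \<alpha>) * EU ?m"
    using \<alpha> L E by (intro add_less_le_mono mult_strict_left_mono mult_left_mono) auto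
  finally show ?thesis
    by (simp only: V)
qed

section \<open>Existence and uniqueness of the maximizer\<close>

lemma continuous_on_alpha_meu: "K \<subseteq> \<Theta> \<Longrightarrow> continuous_on K (V \<alpha>)"
proof -
  assume K: "K \<subseteq> \<Theta>"
  have "continuous_on K (\<lambda>\<theta>. u (W \<theta> s))" if "s \<in> D" for s
    using K that
    by (intro continuous_on_compose2[OF continuous_u])
       (auto simp: wealth_def admissible_iff intro!: continuous_intros)
  then show ?thesis
    unfolding alpha_meu_mean_std_dev std_dev_def expectation_def
    by (intro continuous_intros) auto
qed

text \<open>A state paying more than the price limits short positions, a state paying less limits
  long ones.\<close>

lemma admissible_bounded:
  obtains M where "\<And>\<theta>. \<theta> \<in> \<Theta> \<Longrightarrow> \<bar>\<theta>\<bar> \<le> M"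
proof -
  obtain s t where st: "s \<in> D" "t \<in> D" "\<pi> < S s" "S t < \<pi>"
    using ex_above ex_below by blast
  have "\<bar>\<theta>\<bar> \<le> w0 / (S s - \<pi>) + w0 / (\<pi> - S t)" if "\<theta> \<in> \<Theta>" for \<theta>
  proof -
    have "- \<theta> < w0 / (S s - \<pi>)" "\<theta> < w0 / (\<pi> - S t)"
      using that st unfolding admissible_iff
      by (auto simp: wealth_def field_simps dest!: bspec[of _ _ s] bspec[of _ _ t])
    moreover have "0 < w0 / (S s - \<pi>)" "0 < w0 / (\<pi> - S t)"
      using st w0_pos by auto
    ultimately show ?thesis by linarith
  qed
  then show ?thesis using that by blast
qed

text \<open>Wealth is bounded on the admissible set, so a sufficiently low utility in one state of
  positive weight cannot be offset by the others.\<close>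

lemma alpha_meu_near_boundary:
  assumes \<alpha>: "1/2 < \<alpha>"
  obtains e where "0 < e" "e \<le> w0" "\<And>\<theta>. \<theta> \<in> \<Theta> \<Longrightarrow> \<exists>s\<in>D. W \<theta> s < e \<Longrightarrow> V \<alpha> \<theta> < V \<alpha> 0"
proof -
  obtain M where M: "\<And>\<theta>. \<theta> \<in> \<Theta> \<Longrightarrow> \<bar>\<theta>\<bar> \<le> M"
    using admissible_bounded by blast
  \<comment> \<open>The sum dominates each of its terms, so \<open>B\<close> bounds wealth uniformly
    in demand and state.\<close>
  define B where "B = w0 + (\<Sum>s\<in>D. M * \<bar>S s - \<pi>\<bar>)"
  have M0: "0 \<le> M"
    using M[OF zero_admissible] by simp
  have WB: "W \<theta> s \<le> B" if "\<theta> \<in> \<Theta>" "s \<in> D" for \<theta> s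
  proof -
    have "\<theta> * (S s - \<pi>) \<le> \<bar>\<theta>\<bar> * \<bar>S s - \<pi>\<bar>"
      by (simp add: abs_le_iff flip: abs_mult)
    also have "\<dots> \<le> M * \<bar>S s - \<pi>\<bar>"
      using M[OF that(1)] by (intro mult_right_mono) auto
    also have "\<dots> \<le> (\<Sum>s\<in>D. M * \<bar>S s - \<pi>\<bar>)"
      using that M0 finite_D by (intro member_le_sum) auto
    finally show ?thesis
      by (simp add: wealth_def B_def)
  qed
  \<comment> \<open>The threshold solves \<open>p0 s * z + (1 - p0 s) * u B = u w0\<close> for the
    utility \<open>z\<close> in state \<open>s\<close>.\<close>
  have "\<forall>\<^sub>F x in at_right 0. \<forall>s\<in>D. u x < (u w0 - (1 - p0 s) * u B) / p0 s"
    using u_at_bot finite_D by (intro eventually_ball_finite) (auto simp: filterlim_at_bot_dense)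
  then obtain b where b: "0 < b"
    "\<And>x s. 0 < x \<Longrightarrow> x < b \<Longrightarrow> s \<in> D \<Longrightarrow> u x < (u w0 - (1 - p0 s) * u B) / p0 s"
    by (auto simp: eventually_at_right_field)
  show ?thesis
  \<comment> \<open>Capping at \<open>w0\<close> keeps zero demand, with constant wealth
    \<open>w0\<close>, among the demands whose wealth is at least \<open>e\<close>.\<close>
  proof (rule that[of "min b w0"])
    fix \<theta> assume \<theta>: "\<theta> \<in> \<Theta>" and "\<exists>s\<in>D. W \<theta> s < min b w0"
    then obtain s where s: "s \<in> D" "W \<theta> s < b" by auto
    have "V \<alpha> \<theta> \<le> EU \<theta>"
      by (rule alpha_meu_le_expectation[OF \<alpha>])
    also have "\<dots> = p0 s * u (W \<theta> s) + (\<Sum>t\<in>D - {s}. p0 t * u (W \<theta> t))"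
      unfolding expectation_def by (rule sum.remove[OF finite_D s(1)])
    also have "(\<Sum>t\<in>D - {s}. p0 t * u (W \<theta> t)) \<le> (\<Sum>t\<in>D - {s}. p0 t * u B)"
      using \<theta> WB by (intro sum_mono mult_left_mono u_mono) (auto simp: admissible_iff less_imp_le[OF p0_pos])
    also have "\<dots> = (1 - p0 s) * u B"
      using sum.remove[OF finite_D s(1), of p0] by (simp add: p0_sum flip: sum_distrib_right)
    also have "p0 s * u (W \<theta> s) + (1 - p0 s) * u B < u w0"
      using b(2)[of "W \<theta> s" s] s \<theta> p0_pos[OF s(1)] by (auto simp: admissible_iff field_simps)
    finally show "V \<alpha> \<theta> < V \<alpha> 0"
      by (simp add: alpha_meu_0)
  qed (use b w0_pos in auto)
qed

text \<open>Demands leaving wealth at least \<open>e\<close> in every state form a compact set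
  containing 0. All other admissible demands are worse than 0, so a maximizer on the compact set is
  global.\<close>

lemma ex_maximizer:
  assumes "1/2 < \<alpha>"
  shows "\<exists>\<theta>\<in>\<Theta>. \<forall>\<eta>\<in>\<Theta>. V \<alpha> \<eta> \<le> V \<alpha> \<theta>"
proof -
  obtain e where e: "0 < e" "e \<le> w0"
    "\<And>\<theta>. \<theta> \<in> \<Theta> \<Longrightarrow> \<exists>s\<in>D. W \<theta> s < e \<Longrightarrow> V \<alpha> \<theta> < V \<alpha> 0"
    using alpha_meu_near_boundary[OF assms] by blast
  define K where "K = {\<theta>. \<forall>s\<in>D. e \<le> W \<theta> s}"
  have K: "K \<subseteq> \<Theta>"
    using e(1) by (force simp: K_def admissible_iff)
  obtain M where "\<And>\<theta>. \<theta> \<in> \<Theta> \<Longrightarrow> \<bar>\<theta>\<bar> \<le> M"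
    using admissible_bounded by blast
  with K have "bounded K"
    by (auto simp: bounded_iff)
  moreover have "closed K"
    unfolding K_def wealth_def Ball_def imp_conv_disj
    by (intro closed_Collect_all closed_Collect_disj closed_Collect_le continuous_intros) auto
  ultimately have "compact K"
    by (simp add: compact_eq_bounded_closed)
  moreover have "0 \<in> K"
    using e by (simp add: K_def wealth_def)
  ultimately obtain \<theta> where \<theta>: "\<theta> \<in> K" "\<And>\<eta>. \<eta> \<in> K \<Longrightarrow> V \<alpha> \<eta> \<le> V \<alpha> \<theta>"
    using continuous_attains_sup[OF _ _ continuous_on_alpha_meu[OF K]] by blast
  have "V \<alpha> \<eta> \<le> V \<alpha> \<theta>" if "\<eta> \<in> \<Theta>" for \<eta>
  proof (cases "\<eta> \<in> K")
    case False
    then have "V \<alpha> \<eta> < V \<alpha> 0"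
      using that by (intro e(3)) (auto simp: K_def not_le)
    with \<theta>(2)[OF \<open>0 \<in> K\<close>] show ?thesis by simp
  qed (rule \<theta>(2))
  with \<theta>(1) K show ?thesis by blast
qed

text \<open>A second maximizer would be beaten by its midpoint with the first, so the description
  operator picks a genuine maximizer.\<close>

lemma optimal_demand:
  assumes "1/2 < \<alpha>" "\<alpha> \<le> 1"
  shows "\<theta>opt \<alpha> \<in> \<Theta>" "\<eta> \<in> \<Theta> \<Longrightarrow> \<eta> \<noteq> \<theta>opt \<alpha> \<Longrightarrow> V \<alpha> \<eta> < V \<alpha> (\<theta>opt \<alpha>)"
proof -
  obtain \<theta> where \<theta>: "\<theta> \<in> \<Theta>" "\<And>\<eta>. \<eta> \<in> \<Theta> \<Longrightarrow> V \<alpha> \<eta> \<le> V \<alpha> \<theta>"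
    using ex_maximizer[OF assms(1)] by blast
  have less: "V \<alpha> \<eta> < V \<alpha> \<theta>" if "\<eta> \<in> \<Theta>" "\<eta> \<noteq> \<theta>" for \<eta>
    using order.strict_trans2[OF alpha_meu_midpoint[OF assms that(1) \<theta>(1) that(2)]
        \<theta>(2)[OF midpoint_admissible[OF that(1) \<theta>(1)]]]
    by simp
  have "\<theta>opt \<alpha> = \<theta>"
    unfolding optimal_demand_def is_arg_max_linorder
    using \<theta> less by (intro the_equality) (auto simp: not_less[symmetric])
  with \<theta> less show "\<theta>opt \<alpha> \<in> \<Theta>" "\<eta> \<in> \<Theta> \<Longrightarrow> \<eta> \<noteq> \<theta>opt \<alpha> \<Longrightarrow> V \<alpha> \<eta> < V \<alpha> (\<theta>opt \<alpha>)"
    by auto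
qed

section \<open>Sign of the optimal demand\<close>

lemma expectation_wealth: "expectation D p0 (W \<theta>) = w0 + \<theta> * (expectation D p0 S - \<pi>)"
proof -
  have "expectation D p0 (W \<theta>) = (\<Sum>s\<in>D. (w0 - \<theta> * \<pi>) * p0 s + \<theta> * (p0 s * S s))"
    unfolding expectation_def by (intro sum.cong) (auto simp: wealth_def algebra_simps)
  also have "\<dots> = (w0 - \<theta> * \<pi>) * (\<Sum>s\<in>D. p0 s) + \<theta> * expectation D p0 S"
    by (simp only: sum.distrib sum_distrib_left expectation_def)
  finally show ?thesis
    by (simp add: p0_sum algebra_simps)
qed

lemma jensen_wealth:
  assumes "\<theta> \<in> \<Theta>"
  shows "EU \<theta> \<le> u (w0 + \<theta> * (expectation D p0 S - \<pi>))"
proof -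
  have "convex_on {0<..} (\<lambda>x. - u x)"
  proof (rule convex_onI)
    fix t x y :: real assume "0 < t" "t < 1" "x \<in> {0<..}" "y \<in> {0<..}"
    then show "- u ((1 - t) *\<^sub>R x + t *\<^sub>R y) \<le> (1 - t) * - u x + t * - u y"
      using concave_u[unfolded strictly_concave_on_def, THEN conjunct2, rule_format, of x y t]
      by (cases "x = y") (auto simp: algebra_simps)
  qed simp
  then have "- u (\<Sum>s\<in>D. p0 s *\<^sub>R W \<theta> s) \<le> (\<Sum>s\<in>D. p0 s * - u (W \<theta> s))"
    using assms p0_sum finite_D ex_above
    by (intro convex_on_sum) (auto simp: admissible_iff less_imp_le[OF p0_pos])
  then show ?thesis
    by (simp add: expectation_wealth[symmetric]) (simp add: expectation_def sum_negf)
qed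

text \<open>Zero demand secures \<open>u w0\<close>, which a nonzero optimum exceeds. The criterion
  is at most expected utility, so by Jensen mean wealth must exceed \<open>w0\<close>.\<close>

lemma optimal_demand_sign:
  assumes "1/2 < \<alpha>" "\<alpha> \<le> 1"
  shows "0 \<le> \<theta>opt \<alpha> * (expectation D p0 S - \<pi>)"
proof (rule ccontr)
  let ?\<theta> = "\<theta>opt \<alpha>" and ?x = "w0 + \<theta>opt \<alpha> * (expectation D p0 S - \<pi>)"
  assume neg: "\<not> 0 \<le> ?\<theta> * (expectation D p0 S - \<pi>)"
  have \<theta>: "?\<theta> \<in> \<Theta>"
    using optimal_demand(1)[OF assms] .
  have "?\<theta> \<noteq> 0"
    using neg by auto
  then have "u w0 < V \<alpha> ?\<theta>"
    using optimal_demand(2)[OF assms zero_admissible] by (simp add: alpha_meu_0)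
  also have "\<dots> \<le> EU ?\<theta>"
    using assms by (intro alpha_meu_le_expectation)
  also have "\<dots> \<le> u ?x"
    by (rule jensen_wealth[OF \<theta>])
  finally have "u w0 < u ?x" .
  \<comment> \<open>Monotonicity of \<open>u\<close> is available only at positive
    arguments.\<close>
  moreover have "0 < ?x"
    unfolding expectation_wealth[symmetric] expectation_def[of _ _ "W _"] using \<theta> finite_D ex_above
    by (intro sum_pos) (auto simp: admissible_iff p0_pos)
  ultimately show False
    using neg u_mono[of ?x w0] by linarith
qed

text \<open>Revealed preference: of two optimal demands, the one for the larger \<open>\<alpha>\<close> has the smaller
  standard deviation and the smaller expectation of utility, the latter being at least \<open>u w0\<close>.
  If it were the larger demand, then every state's utility would be further from \<open>u w0\<close>, and the
  decomposition of second moments about \<open>u w0\<close> would force a larger standard deviation.\<close>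

lemma abs_optimal_demand_antimono:
  assumes \<alpha>\<beta>: "1/2 < \<alpha>" "\<alpha> \<le> \<beta>" "\<beta> \<le> 1" and same_sign: "0 \<le> \<theta>opt \<alpha> * \<theta>opt \<beta>"
  shows "\<bar>\<theta>opt \<beta>\<bar> \<le> \<bar>\<theta>opt \<alpha>\<bar>"
proof (rule ccontr)
  let ?a = "\<theta>opt \<alpha>" and ?b = "\<theta>opt \<beta>"
  assume "\<not> \<bar>?b\<bar> \<le> \<bar>?a\<bar>"
  then have ab: "\<bar>?a\<bar> \<le> \<bar>?b\<bar>" "?a \<noteq> ?b"
    by auto
  have adm: "?a \<in> \<Theta>" "?b \<in> \<Theta>"
    using \<alpha>\<beta> by (auto intro: optimal_demand)
  have pref_\<alpha>: "EU ?b - ambiguity_delta c \<alpha> * SU ?b < EU ?a - ambiguity_delta c \<alpha> * SU ?a"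
    using optimal_demand(2)[of \<alpha> ?b] \<alpha>\<beta> adm ab by (simp add: alpha_meu_mean_std_dev)
  have pref_\<beta>: "EU ?a - ambiguity_delta c \<beta> * SU ?a < EU ?b - ambiguity_delta c \<beta> * SU ?b"
    using optimal_demand(2)[of \<beta> ?a] \<alpha>\<beta> adm ab by (simp add: alpha_meu_mean_std_dev)
  \<comment> \<open>Adding the two preferences cancels the expected utilities.\<close>
  have "0 < (ambiguity_delta c \<beta> - ambiguity_delta c \<alpha>) * (SU ?a - SU ?b)"
    using pref_\<alpha> pref_\<beta> by (simp add: algebra_simps)
  then have S: "SU ?b < SU ?a"
    using ambiguity_delta_mono[OF \<alpha>\<beta>(2)] by (auto simp: zero_less_mult_iff)
  have "0 \<le> ambiguity_delta c \<alpha> * (SU ?a - SU ?b)"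
    using S ambiguity_delta_nonneg[OF \<alpha>\<beta>(1)] by simp
  then have E: "EU ?b < EU ?a"
    using pref_\<alpha> by (simp add: algebra_simps)
  \<comment> \<open>This bound is what allows squaring the inequality between the expected utilities
    measured from \<open>u w0\<close>.\<close>
  have "u w0 \<le> V \<beta> ?b"
    using optimal_demand(2)[of \<beta> 0] \<alpha>\<beta> zero_admissible by (cases "?b = 0") (auto simp: alpha_meu_0)
  also have "\<dots> \<le> EU ?b"
    using \<alpha>\<beta> by (intro alpha_meu_le_expectation) auto
  finally have E0: "u w0 \<le> EU ?b" .
  have sq: "(u (W ?a s) - u w0)\<^sup>2 \<le> (u (W ?b s) - u w0)\<^sup>2" if s: "s \<in> D" for s
  proof -
    define x y where "x = ?a * (S s - \<pi>)" and "y = ?b * (S s - \<pi>)"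
    have "\<bar>x\<bar> \<le> \<bar>y\<bar>"
      using ab by (simp add: x_def y_def abs_mult mult_right_mono)
    moreover have "0 \<le> x * y"
    proof -
      have "x * y = (?a * ?b) * (S s - \<pi>)\<^sup>2"
        by (simp add: x_def y_def power2_eq_square)
      with same_sign show ?thesis by simp
    qed
    ultimately consider "0 \<le> x" "x \<le> y" | "y \<le> x" "x \<le> 0"
      by (auto simp: zero_le_mult_iff abs_if split: if_splits)
    then have "\<bar>u (w0 + x) - u w0\<bar> \<le> \<bar>u (w0 + y) - u w0\<bar>"
    proof cases
      case 1
      then show ?thesis
        using u_mono[of w0 "w0 + x"] u_mono[of "w0 + x" "w0 + y"] w0_pos by auto
    next
      case 2
      moreover have "0 < w0 + y" "0 < w0 + x"
        using adm s by (auto simp: admissible_iff wealth_def x_def y_def)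
      ultimately show ?thesis
        using u_mono[of "w0 + x" w0] u_mono[of "w0 + y" "w0 + x"] by auto
    qed
    then show ?thesis
      by (simp add: wealth_def x_def y_def abs_le_square_iff)
  qed
  \<comment> \<open>From \<open>?a\<close> to \<open>?b\<close> the second moment about
    \<open>u w0\<close> does not fall and the subtracted squared bias does not grow.\<close>
  have "(SU ?a)\<^sup>2 = expectation D p0 (\<lambda>s. (u (W ?a s) - u w0)\<^sup>2) - (EU ?a - u w0)\<^sup>2"
    by (rule std_dev_power2_shift)
  also have "\<dots> \<le> expectation D p0 (\<lambda>s. (u (W ?b s) - u w0)\<^sup>2) - (EU ?b - u w0)\<^sup>2"
    unfolding expectation_def[of D p0 "\<lambda>s. (_ s)\<^sup>2"]
    using E E0 sq p0_pos
    by (intro diff_mono sum_mono mult_left_mono sq power_mono) (auto intro: less_imp_le)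
  also have "\<dots> = (SU ?b)\<^sup>2"
    by (rule std_dev_power2_shift[symmetric])
  finally have "SU ?a \<le> SU ?b"
    by (rule power2_le_imp_le[OF _ std_dev_nonneg])
  with S show False by simp
qed

end

section \<open>Utility near zero wealth\<close>

text \<open>The bound makes \<open>x * deriv u x\<close> nonincreasing, so \<open>deriv u x\<close>
  is at least \<open>deriv u 1 / x\<close> for \<open>0 < x \<le> 1\<close>. Integration puts
  \<open>u x\<close> below \<open>u 1 + deriv u 1 * ln x\<close>.\<close>

lemma filterlim_at_bot_if_relative_risk_aversion_ge_1:
  fixes u :: "real \<Rightarrow> real"
  assumes mono: "mono_on {0<..} u"
    and diff: "\<And>x. 0 < x \<Longrightarrow> u differentiable at x"
    and diff2: "\<And>x. 0 < x \<Longrightarrow> deriv u differentiable at x"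
    and rra: "\<And>x. 0 < x \<Longrightarrow> 1 \<le> - x * deriv (deriv u) x / deriv u x"
  shows "filterlim u at_bot (at_right 0)"
proof -
  have d1: "(u has_real_derivative deriv u x) (at x)" if "0 < x" for x
    using diff[OF that] by (simp add: DERIV_deriv_iff_real_differentiable)
  have d2: "(deriv u has_real_derivative deriv (deriv u) x) (at x)" if "0 < x" for x
    using diff2[OF that] by (simp add: DERIV_deriv_iff_real_differentiable)
  \<comment> \<open>Monotonicity gives only a nonnegative derivative. A zero one would turn the
    quotient in \<open>rra\<close> into 0, by the convention for division by zero.\<close>
  have pos: "0 < deriv u x" if "0 < x" for x
  proof -
    have "0 \<le> deriv u x"
      using that by (intro mono_on_imp_deriv_nonneg[OF mono d1]) (auto simp: interior_open)
    moreover have "deriv u x \<noteq> 0"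
      using rra[OF that] by auto
    ultimately show ?thesis by simp
  qed
  have decr: "1 * deriv u 1 \<le> x * deriv u x" if "0 < x" "x \<le> 1" for x
  proof (rule DERIV_nonpos_imp_nonincreasing[OF that(2)])
    fix y assume "x \<le> y"
    then have y: "0 < y" using that by simp
    show "\<exists>d. ((\<lambda>y. y * deriv u y) has_real_derivative d) (at y) \<and> d \<le> 0"
      using rra[OF y] pos[OF y]
      by (intro exI[of _ "deriv u y + y * deriv (deriv u) y"])
         (auto intro!: derivative_eq_intros d2 y simp: field_simps)
  qed
  have le: "u x \<le> u 1 + deriv u 1 * ln x" if "0 < x" "x \<le> 1" for x
  proof -
    have "u x - deriv u 1 * ln x \<le> u 1 - deriv u 1 * ln 1"
    proof (rule DERIV_nonneg_imp_nondecreasing[OF that(2)])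
      fix y assume "x \<le> y" "y \<le> 1"
      then have y: "0 < y" using that by simp
      show "\<exists>d. ((\<lambda>y. u y - deriv u 1 * ln y) has_real_derivative d) (at y) \<and> 0 \<le> d"
        using decr[OF y \<open>y \<le> 1\<close>] y
        by (intro exI[of _ "deriv u y - deriv u 1 / y"])
           (auto intro!: derivative_eq_intros d1 simp: field_simps)
    qed
    then show ?thesis by simp
  qed
  have "filterlim (\<lambda>x. u 1 + deriv u 1 * ln x) at_bot (at_right 0)"
    using pos[of 1]
    by (intro filterlim_tendsto_add_at_bot_iff[THEN iffD2, OF tendsto_const]
        filterlim_tendsto_pos_mult_at_bot[OF tendsto_const _ ln_at_0]) auto
  moreover have "\<forall>\<^sub>F x in at_right 0. u x \<le> u 1 + deriv u 1 * ln x"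
    using le by (auto simp: eventually_at_right_field intro!: exI[of _ 1])
  ultimately show ?thesis
    unfolding filterlim_at_bot by (blast intro: eventually_elim2 order_trans)
qed

theorem proposition2p9:
  fixes D :: "'s set" and p0 S :: "'s \<Rightarrow> real" and c w0 \<pi> :: real
    and U :: "real set" and u :: "real \<Rightarrow> real"
  assumes "finite D" and "card D \<ge> 2"
    and "\<forall>s\<in>D. p0 s > 0" and "(\<Sum>s\<in>D. p0 s) = 1"
    and "c \<ge> 1" and "c < Min ((\<lambda>s. 1 / (1 - p0 s)) ` D)"
    and "\<not> S constant_on D"
    and "U = UNIV \<and> filterlim (deriv u) at_top at_bot
       \<or> U = {0<..} \<and> w0 > 0 \<and> filterlim (deriv u) at_top (at_right 0)"
    and "(deriv u \<longlongrightarrow> 0) at_top"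
    and "strict_mono_on U u" and "strictly_concave_on U u"
    and "\<forall>x\<in>U. u differentiable at x" and "\<forall>x\<in>U. deriv u differentiable at x"
    and "\<forall>x\<in>U. - x * deriv (deriv u) x / deriv u x \<ge> 1"
  shows "mono_on {\<alpha> \<in> {1/2<..1}. \<pi> \<in> {upper_price D p0 c S \<alpha><..<Max (S ` D)}}
           (\<lambda>\<alpha>. optimal_demand U D p0 c S u w0 \<pi> \<alpha>)
       \<and> antimono_on {\<alpha> \<in> {1/2<..1}. \<pi> \<in> {Min (S ` D)<..<lower_price D p0 c S \<alpha>}}
           (\<lambda>\<alpha>. optimal_demand U D p0 c S u w0 \<pi> \<alpha>)"
proof -
  \<comment> \<open>For \<open>U = UNIV\<close> the bound on the relative risk aversion fails at \<open>x = 0\<close>.\<close>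
  have "0 \<notin> U"
    using assms(14) by force
  then have U: "U = {0<..}" and w0: "0 < w0"
    using assms(8) by auto
  have "D \<noteq> {}"
    using assms(4) by auto
  interpret ambiguity_ball D p0 c
    using assms \<open>D \<noteq> {}\<close> by unfold_locales auto
  have u_bot: "filterlim u at_bot (at_right 0)"
    using assms(10,12-14) unfolding U
    by (intro filterlim_at_bot_if_relative_risk_aversion_ge_1) (auto intro: strict_mono_on_imp_mono_on)
  have u_cont: "continuous_on {0<..} u"
    using assms(12) unfolding U
    by (intro continuous_at_imp_continuous_on) (auto intro: differentiable_imp_continuous_within)
  have market: "robust_market D p0 c S u w0 \<pi>" if "\<exists>s\<in>D. \<pi> < S s" "\<exists>s\<in>D. S s < \<pi>"
    using assms(10,11) w0 u_bot u_cont that unfolding U by unfold_locales auto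
  \<comment> \<open>In either price range the price is thus strictly beyond the mean payoff, which
    fixes the sign of the expected excess payoff.\<close>
  have spread: "0 \<le> \<bar>ambiguity_delta c \<alpha>\<bar> * std_dev D p0 S" for \<alpha>
    by (simp add: std_dev_nonneg)
  show ?thesis
  proof (intro conjI monotone_onI)
    fix \<alpha> \<beta> assume
      \<alpha>: "\<alpha> \<in> {\<alpha> \<in> {1/2<..1}. \<pi> \<in> {upper_price D p0 c S \<alpha><..<Max (S ` D)}}" and
      \<beta>: "\<beta> \<in> {\<alpha> \<in> {1/2<..1}. \<pi> \<in> {upper_price D p0 c S \<alpha><..<Max (S ` D)}}" and
      "\<alpha> \<le> \<beta>"
    have above: "\<exists>s\<in>D. \<pi> < S s"
      using \<alpha> assms(1) \<open>D \<noteq> {}\<close> by (simp add: Max_gr_iff)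
    have mean: "expectation D p0 S < \<pi>"
      using \<alpha> spread[of \<alpha>] by (simp add: upper_price_def)
    have below: "\<exists>s\<in>D. S s < \<pi>"
    proof (rule ccontr)
      assume "\<not> ?thesis"
      then have "expectation D p0 (\<lambda>s. \<pi>) \<le> expectation D p0 S"
        unfolding expectation_def
        by (intro sum_mono mult_left_mono) (auto simp: less_imp_le[OF p0_pos] not_less)
      with mean show False by (simp add: expectation_const)
    qed
    interpret robust_market D p0 c S u w0 \<pi>
      using market[OF above below] .
    \<comment> \<open>Both demands are nonpositive, so a smaller absolute value is a larger
      demand.\<close>
    have "\<theta>opt \<alpha> \<le> 0" "\<theta>opt \<beta> \<le> 0"
      using optimal_demand_sign[of \<alpha>] optimal_demand_sign[of \<beta>] \<alpha> \<beta> mean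
      by (auto simp: zero_le_mult_iff)
    moreover from this have "\<bar>\<theta>opt \<beta>\<bar> \<le> \<bar>\<theta>opt \<alpha>\<bar>"
      using \<alpha> \<beta> \<open>\<alpha> \<le> \<beta>\<close> by (intro abs_optimal_demand_antimono) (auto simp: mult_nonpos_nonpos)
    ultimately show "optimal_demand U D p0 c S u w0 \<pi> \<alpha> \<le> optimal_demand U D p0 c S u w0 \<pi> \<beta>"
      unfolding U by simp
  next
    fix \<alpha> \<beta> assume
      \<alpha>: "\<alpha> \<in> {\<alpha> \<in> {1/2<..1}. \<pi> \<in> {Min (S ` D)<..<lower_price D p0 c S \<alpha>}}" and
      \<beta>: "\<beta> \<in> {\<alpha> \<in> {1/2<..1}. \<pi> \<in> {Min (S ` D)<..<lower_price D p0 c S \<alpha>}}" and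
      "\<alpha> \<le> \<beta>"
    have below: "\<exists>s\<in>D. S s < \<pi>"
      using \<alpha> assms(1) \<open>D \<noteq> {}\<close> by (simp add: Min_less_iff)
    have mean: "\<pi> < expectation D p0 S"
      using \<alpha> spread[of \<alpha>] by (simp add: lower_price_def)
    have above: "\<exists>s\<in>D. \<pi> < S s"
    proof (rule ccontr)
      assume "\<not> ?thesis"
      then have "expectation D p0 S \<le> expectation D p0 (\<lambda>s. \<pi>)"
        unfolding expectation_def
        by (intro sum_mono mult_left_mono) (auto simp: less_imp_le[OF p0_pos] not_less)
      with mean show False by (simp add: expectation_const)
    qed
    interpret robust_market D p0 c S u w0 \<pi>
      using market[OF above below] .
    \<comment> \<open>Here both demands are nonnegative, so a smaller absolute value is a smaller
      demand.\<close>
    have "0 \<le> \<theta>opt \<alpha>" "0 \<le> \<theta>opt \<beta>"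
      using optimal_demand_sign[of \<alpha>] optimal_demand_sign[of \<beta>] \<alpha> \<beta> mean
      by (auto simp: zero_le_mult_iff)
    moreover from this have "\<bar>\<theta>opt \<beta>\<bar> \<le> \<bar>\<theta>opt \<alpha>\<bar>"
      using \<alpha> \<beta> \<open>\<alpha> \<le> \<beta>\<close> by (intro abs_optimal_demand_antimono) auto
    ultimately show "optimal_demand U D p0 c S u w0 \<pi> \<beta> \<le> optimal_demand U D p0 c S u w0 \<pi> \<alpha>"
      unfolding U by simp
  qed
qed

end
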